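(* Let $F$ be a finite field, $\Gamma$ a nonempty set, $\varphi:\Gamma\to\Gamma$ a self-map, $\mathfrak{w}=(\mathfrak{w}_\alpha)_{\alpha\in\Gamma}\in F^\Gamma$, and let $\sigma_{\varphi,\mathfrak{w}}:F^\Gamma\to F^\Gamma$, $\sigma_{\varphi,\mathfrak{w}}((x_\alpha)_{\alpha\in\Gamma})=(\mathfrak{w}_\alpha x_{\varphi(\alpha)})_{\alpha\in\Gamma}$. Suppose $\sigma_{\varphi,\mathfrak{w}}(\bigoplus_{\Gamma}F)\subseteq\bigoplus_{\Gamma}F$. The following statements are equivalent: 1. there exists an infinite $\varphi$-anti-orbit $\{\alpha_n\}_{n\geq1}$ in $\mathrm{supp}(\mathfrak{w})$; 2. $\mathrm{ent}_{\mathrm{set}}(\sigma_{\varphi,\mathfrak{w}}\restriction_{\bigoplus_{\Gamma}F})=+\infty$; 3. $\mathrm{ent}_{\mathrm{set}}(\sigma_{\varphi,\mathfrak{w}}\restriction_{\bigoplus_{\Gamma}F})>0$; 4. there exists $\beta\in\Gamma$ such that $\{\sigma_{\varphi,\mathfrak{w}}^n(\mathsf{e}_\beta)\}_{n\geq1}$ is a one-to-one sequence. Consequently, $\mathrm{ent}_{\mathrm{set}}(\sigma_{\varphi,\mathfrak{w}}\restriction_{\bigoplus_{\Gamma}F})=+\infty$ if there exists a one-to-one $\varphi$-anti-orbit sequence in $\mathrm{supp}(\mathfrak{w})$, and it equals $0$ otherwise.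
   Context: For $x\in F^\Gamma$, $\mathrm{supp}(x)=\{\alpha\in\Gamma:x_\alpha\neq0\}$, and $\bigoplus_\Gamma F=\{x\in F^\Gamma:\mathrm{supp}(x)\text{ is finite}\}$. For $\beta\in\Gamma$, $\mathsf{e}_\beta\in F^\Gamma$ has $\beta$-th coordinate $1$ and all other coordinates $0$. For a self-map $f:A\to A$: an $f$-orbit is a sequence $\{a_n\}_{n\geq1}$ with $f(a_n)=a_{n+1}$ for all $n$; an $f$-anti-orbit is a sequence with $f(a_{n+1})=a_n$ for all $n\geq 1$. A sequence is one-to-one if its terms are pairwise distinct; it is infinite if its set of terms is infinite. For finite $D\subseteq A$ let $\mathfrak{h}(f,D)=\lim_{n\to\infty}\frac{|D\cup f(D)\cup\cdots\cup f^{n-1}(D)|}{n}$ (the limit always exists), and $\mathrm{ent}_{\mathrm{set}}(f)=\sup\{\mathfrak{h}(f,D):D\subseteq A\text{ finite}\}$. It is known that $\mathrm{ent}_{\mathrm{set}}(f)=\mathsf{o}(f)$, the supremum of $\{0\}$ together with all $n\geq1$ such that there exist $n$ pairwise disjoint one-to-one $f$-orbits in $A$. *)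

theory Defs
  imports Complex_Main "HOL-Library.Extended_Real"
begin

definition supp :: "('g \<Rightarrow> 'f::zero) \<Rightarrow> 'g set" where
  "supp x = {\<alpha>. x \<alpha> \<noteq> 0}"

definition direct_sum :: "('g \<Rightarrow> 'f::zero) set" where
  "direct_sum = {x. finite (supp x)}"

definition basis_vec :: "'g \<Rightarrow> 'g \<Rightarrow> 'f::zero_neq_one" where
  "basis_vec \<beta> = (\<lambda>\<alpha>. if \<alpha> = \<beta> then 1 else 0)"

definition wshift :: "('g \<Rightarrow> 'g) \<Rightarrow> ('g \<Rightarrow> 'f::times) \<Rightarrow> ('g \<Rightarrow> 'f) \<Rightarrow> ('g \<Rightarrow> 'f)" where
  "wshift \<phi> w x = (\<lambda>\<alpha>. w \<alpha> * x (\<phi> \<alpha>))"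

text \<open>Sequences are indexed by the positive integers; the value at 0 is irrelevant.\<close>

definition anti_orbit :: "('a \<Rightarrow> 'a) \<Rightarrow> (nat \<Rightarrow> 'a) \<Rightarrow> bool" where
  "anti_orbit f a \<longleftrightarrow> (\<forall>n\<ge>1. f (a (Suc n)) = a n)"

definition seq_in :: "(nat \<Rightarrow> 'a) \<Rightarrow> 'a set \<Rightarrow> bool" where
  "seq_in a S \<longleftrightarrow> (\<forall>n\<ge>1. a n \<in> S)"

definition one_to_one_seq :: "(nat \<Rightarrow> 'a) \<Rightarrow> bool" where
  "one_to_one_seq a \<longleftrightarrow> inj_on a {1..}"

definition infinite_seq :: "(nat \<Rightarrow> 'a) \<Rightarrow> bool" where
  "infinite_seq a \<longleftrightarrow> infinite (a ` {1..})"

definition set_entropy_of :: "('a \<Rightarrow> 'a) \<Rightarrow> 'a set \<Rightarrow> real" where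
  "set_entropy_of f D = lim (\<lambda>n. real (card (\<Union>i<n. (f ^^ i) ` D)) / real n)"

text \<open>The set-theoretic entropy of the restriction of \<open>f\<close> to \<open>A\<close>, for \<open>f\<close> mapping \<open>A\<close>
  into itself. Since \<open>D\<close> ranges over subsets of \<open>A\<close>, only values of \<open>f\<close> on \<open>A\<close> matter.\<close>

definition ent_set :: "'a set \<Rightarrow> ('a \<Rightarrow> 'a) \<Rightarrow> ereal" where
  "ent_set A f = (SUP D\<in>{D. D \<subseteq> A \<and> finite D}. ereal (set_entropy_of f D))"

end

theory Submission
  imports Defs
begin

text \<open>
  The \<open>n\<close>-th iterate of the shift evaluates at \<open>\<alpha>\<close> to the product of the weights along
  \<open>\<alpha>, \<phi> \<alpha>, \<dots>, \<phi>\<^sup>n\<^sup>-\<^sup>1 \<alpha>\<close> times \<open>x (\<phi>\<^sup>n \<alpha>)\<close>, so supports spread backwards along \<open>\<phi>\<close>-paths inside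
  \<open>supp w\<close>. The invariance of the direct sum makes this backward branching finite. By Koenig's
  lemma, without one-to-one anti-orbits in \<open>supp w\<close> a finite set of vectors only ever reaches a
  finite set of coordinates, hence finitely many vectors. Conversely, an infinite anti-orbit has
  a tail \<open>c\<close> whose start is not periodic. The \<open>n\<close>-th iterate of the indicator of \<open>{c 0, c m}\<close> is
  nonzero at \<open>c j\<close> exactly for \<open>j \<in> {n, n + m}\<close>, so \<open>n\<close> and \<open>m\<close> can be recovered from it, which
  gives arbitrarily many pairwise disjoint one-to-one orbits.
\<close>

section \<open>Entropy of bounded and of free orbit families\<close>

lemma set_entropy_of_eq_0:
  assumes "finite (\<Union>i. (f ^^ i) ` D)"
  shows "set_entropy_of f D = 0"
proof -
  let ?C = "card (\<Union>i. (f ^^ i) ` D)"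
  have "(\<lambda>n. real (card (\<Union>i<n. (f ^^ i) ` D)) / real n) \<longlonglongrightarrow> 0"
  proof (rule real_tendsto_sandwich[where f = "\<lambda>_. 0"])
    show "\<forall>\<^sub>F n in sequentially. real (card (\<Union>i<n. (f ^^ i) ` D)) / real n \<le> real ?C / real n"
      using assms
      by (intro always_eventually allI divide_right_mono of_nat_mono card_mono of_nat_0_le_iff) blast+
    show "(\<lambda>n. real ?C / real n) \<longlonglongrightarrow> 0"
      by (rule lim_const_over_n)
  qed auto
  then show ?thesis
    unfolding set_entropy_of_def by (rule limI)
qed

text \<open>Injectivity on pairs says that the orbits of the points of \<open>D\<close> are
  one-to-one and pairwise disjoint, so the first \<open>n\<close> steps cover exactly
  \<open>n * card D\<close> points.\<close>

lemma set_entropy_of_eq_card: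
  assumes "finite D" and "inj_on (\<lambda>(i, x). (f ^^ i) x) (UNIV \<times> D)"
  shows "set_entropy_of f D = real (card D)"
proof -
  have "card (\<Union>i<n. (f ^^ i) ` D) = n * card D" for n
  proof -
    have "(\<Union>i<n. (f ^^ i) ` D) = (\<lambda>(i, x). (f ^^ i) x) ` ({..<n} \<times> D)"
      by auto
    moreover have "inj_on (\<lambda>(i, x). (f ^^ i) x) ({..<n} \<times> D)"
      using assms(2) by (rule inj_on_subset) auto
    ultimately show ?thesis
      by (simp add: card_image card_cartesian_product)
  qed
  \<comment> \<open>The quotient is constant only from \<open>n = 1\<close> on, since division by
    zero gives 0 at \<open>n = 0\<close>.\<close>
  then have "\<forall>\<^sub>F n in sequentially. real (card D) = real (card (\<Union>i<n. (f ^^ i) ` D)) / real n"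
    by (intro eventually_sequentiallyI[of 1]) simp
  then have "(\<lambda>n. real (card (\<Union>i<n. (f ^^ i) ` D)) / real n) \<longlonglongrightarrow> real (card D)"
    by (rule Lim_transform_eventually[OF tendsto_const])
  then show ?thesis
    unfolding set_entropy_of_def by (rule limI)
qed

section \<open>Iterates of the weighted shift\<close>

lemma wshift_funpow:
  fixes w :: "'g \<Rightarrow> 'f::comm_monoid_mult"
  shows "(wshift \<phi> w ^^ n) x \<alpha> = (\<Prod>i<n. w ((\<phi> ^^ i) \<alpha>)) * x ((\<phi> ^^ n) \<alpha>)"
proof (induction n arbitrary: \<alpha>)
  case (Suc n)
  have "(wshift \<phi> w ^^ Suc n) x \<alpha> = w \<alpha> * ((\<Prod>i<n. w ((\<phi> ^^ i) (\<phi> \<alpha>))) * x ((\<phi> ^^ n) (\<phi> \<alpha>)))"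
    by (simp add: wshift_def Suc.IH)
  then show ?case
    by (simp add: prod.lessThan_Suc_shift funpow_swap1 mult.assoc del: prod.lessThan_Suc)
qed simp

lemma wshift_funpow_nonzero_iff:
  fixes w :: "'g \<Rightarrow> 'f::idom"
  shows "(wshift \<phi> w ^^ n) x \<alpha> \<noteq> 0 \<longleftrightarrow>
    x ((\<phi> ^^ n) \<alpha>) \<noteq> 0 \<and> (\<forall>i<n. (\<phi> ^^ i) \<alpha> \<in> supp w)"
  by (auto simp: wshift_funpow supp_def)

lemma basis_vec_in_direct_sum: "basis_vec \<beta> \<in> direct_sum"
  by (simp add: direct_sum_def supp_def basis_vec_def)

text \<open>The fibre is the support of the shifted \<open>basis_vec \<gamma>\<close>; this is how
  invariance of the direct sum enters.\<close>

lemma finite_weighted_fibre: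
  fixes w :: "'g \<Rightarrow> 'f::idom"
  assumes "wshift \<phi> w ` direct_sum \<subseteq> direct_sum"
  shows "finite {\<alpha> \<in> supp w. \<phi> \<alpha> = \<gamma>}"
proof -
  have "wshift \<phi> w (basis_vec \<gamma>) \<in> direct_sum"
    by (rule subsetD[OF assms imageI[OF basis_vec_in_direct_sum]])
  moreover have "supp (wshift \<phi> w (basis_vec \<gamma>)) = {\<alpha> \<in> supp w. \<phi> \<alpha> = \<gamma>}"
    by (auto simp: supp_def wshift_def basis_vec_def)
  ultimately show ?thesis
    by (simp add: direct_sum_def)
qed

section \<open>Backward trees and Koenig's lemma\<close>

text \<open>For \<open>S = supp w\<close> this is the union of the supports of all iterates of
  \<open>basis_vec \<gamma>\<close>. The case \<open>n = 0\<close> puts the root in the tree even if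
  it lies outside \<open>S\<close>.\<close>

definition backward_tree :: "('g \<Rightarrow> 'g) \<Rightarrow> 'g set \<Rightarrow> 'g \<Rightarrow> 'g set" where
  "backward_tree \<phi> S \<gamma> = {\<alpha>. \<exists>n. (\<phi> ^^ n) \<alpha> = \<gamma> \<and> (\<forall>i<n. (\<phi> ^^ i) \<alpha> \<in> S)}"

lemma backward_tree_subset_children:
  "backward_tree \<phi> S \<gamma> \<subseteq> insert \<gamma> (\<Union>\<delta>\<in>{\<delta> \<in> S. \<phi> \<delta> = \<gamma>}. backward_tree \<phi> S \<delta>)"
proof
  fix \<alpha> assume "\<alpha> \<in> backward_tree \<phi> S \<gamma>"
  then obtain n where n: "(\<phi> ^^ n) \<alpha> = \<gamma>" "\<forall>i<n. (\<phi> ^^ i) \<alpha> \<in> S"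
    by (auto simp: backward_tree_def)
  show "\<alpha> \<in> insert \<gamma> (\<Union>\<delta>\<in>{\<delta> \<in> S. \<phi> \<delta> = \<gamma>}. backward_tree \<phi> S \<delta>)"
  proof (cases n)
    case (Suc m)
    then have "\<alpha> \<in> backward_tree \<phi> S ((\<phi> ^^ m) \<alpha>)" "(\<phi> ^^ m) \<alpha> \<in> {\<delta> \<in> S. \<phi> \<delta> = \<gamma>}"
      using n by (auto simp: backward_tree_def)
    then show ?thesis by blast
  qed (use n in simp)
qed

text \<open>Cutting a path at its first visit to the root allows the root to be removed from \<open>S\<close>.\<close>

lemma backward_tree_remove_root: "backward_tree \<phi> S \<beta> \<subseteq> backward_tree \<phi> (S - {\<beta>}) \<beta>"
proof
  fix \<alpha> assume "\<alpha> \<in> backward_tree \<phi> S \<beta>"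
  then obtain n where n: "(\<phi> ^^ n) \<alpha> = \<beta>" "\<forall>i<n. (\<phi> ^^ i) \<alpha> \<in> S"
    by (auto simp: backward_tree_def)
  define m where "m = (LEAST m. (\<phi> ^^ m) \<alpha> = \<beta>)"
  have "(\<phi> ^^ m) \<alpha> = \<beta>" "m \<le> n"
    unfolding m_def using n(1) by (auto intro: LeastI Least_le)
  moreover have "(\<phi> ^^ i) \<alpha> \<noteq> \<beta>" if "i < m" for i
    using that not_less_Least unfolding m_def by blast
  ultimately show "\<alpha> \<in> backward_tree \<phi> (S - {\<beta>}) \<beta>"
    using n(2) by (auto simp: backward_tree_def)
qed

lemma funpow_backward_seq:
  assumes "\<And>n. \<phi> (c (Suc n)) = c n"
  shows "(\<phi> ^^ k) (c (n + k)) = c n"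
  by (induction k arbitrary: n) (simp_all add: funpow_swap1 assms)

text \<open>Koenig's lemma: an infinite tree with finite branching has a child with an infinite
  tree, again and again. Working in \<open>S - {\<beta>}\<close> keeps the branch from returning to
  \<open>\<beta>\<close>, which makes it one-to-one.\<close>

lemma infinite_backward_tree_imp_anti_orbit:
  assumes fibre: "\<And>\<gamma>. finite {\<alpha> \<in> S. \<phi> \<alpha> = \<gamma>}"
    and infinite: "infinite (backward_tree \<phi> S \<beta>)"
  shows "\<exists>a. anti_orbit \<phi> a \<and> one_to_one_seq a \<and> seq_in a S"
proof -
  define R where "R = backward_tree \<phi> (S - {\<beta>})"
  have child: "\<exists>\<delta>. infinite (R \<delta>) \<and> \<delta> \<in> S - {\<beta>} \<and> \<phi> \<delta> = \<gamma>" if "infinite (R \<gamma>)" for \<gamma>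
  proof (rule ccontr)
    assume "\<not> ?thesis"
    then have "finite (R \<delta>)" if "\<delta> \<in> {\<delta> \<in> S - {\<beta>}. \<phi> \<delta> = \<gamma>}" for \<delta>
      using that by blast
    moreover have "finite {\<delta> \<in> S - {\<beta>}. \<phi> \<delta> = \<gamma>}"
      by (rule finite_subset[OF _ fibre[of \<gamma>]]) auto
    ultimately have "finite (insert \<gamma> (\<Union>\<delta>\<in>{\<delta> \<in> S - {\<beta>}. \<phi> \<delta> = \<gamma>}. R \<delta>))"
      by blast
    then have "finite (R \<gamma>)"
      unfolding R_def by (rule finite_subset[OF backward_tree_subset_children])
    then show False
      using that by simp
  qed
  have "infinite (R \<beta>)"
    using infinite finite_subset[OF backward_tree_remove_root] unfolding R_def by metis
  \<comment> \<open>Dependent choice, with infinitude of the subtree as the invariant and the clause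
    for \<open>n = 0\<close> fixing the root.\<close>
  then have "\<exists>c. \<forall>n. (infinite (R (c n)) \<and> (n = 0 \<longrightarrow> c n = \<beta>))
      \<and> (c (Suc n) \<in> S - {\<beta>} \<and> \<phi> (c (Suc n)) = c n)"
    by (intro dependent_nat_choice) (use child in blast)+
  then obtain c where c0: "c 0 = \<beta>"
    and step: "\<And>n. c (Suc n) \<in> S - {\<beta>} \<and> \<phi> (c (Suc n)) = c n"
    by blast
  \<comment> \<open>Applying \<open>\<phi> ^^ i\<close> to a collision would give
    \<open>\<beta> = c (j - i)\<close>, but only \<open>c 0\<close> equals
    \<open>\<beta>\<close>.\<close>
  have "c i \<noteq> c j" if "i < j" for i j
  proof
    assume "c i = c j"
    obtain k where j: "j = Suc k + i"
      using \<open>i < j\<close> by (metis add.commute less_iff_Suc_add add_Suc)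
    have "c 0 = (\<phi> ^^ i) (c i)"
      using funpow_backward_seq[of \<phi> c i 0] step by simp
    also have "\<dots> = c (Suc k)"
      using funpow_backward_seq[of \<phi> c i "Suc k"] step \<open>c i = c j\<close> j by simp
    finally show False
      using step[of k] c0 by simp
  qed
  then have "inj_on c {1..}"
    by (metis inj_onI linorder_neqE_nat)
  \<comment> \<open>The root may lie outside \<open>S\<close>; this is harmless because sequences
    start at index 1.\<close>
  moreover have "c n \<in> S" if "n \<ge> 1" for n
    using step[of "n - 1"] that by simp
  ultimately show ?thesis
    using step by (auto simp: anti_orbit_def one_to_one_seq_def seq_in_def intro!: exI[of _ c])
qed

text \<open>All iterates vanish outside the finite set \<open>T\<close> of coordinates reachable
  from supports in \<open>D\<close>, and a finite field admits only finitely many such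
  vectors.\<close>

lemma finite_orbits_of_finite_backward_trees:
  fixes w :: "'g \<Rightarrow> 'f::{idom, finite}"
  assumes "\<And>\<beta>. finite (backward_tree \<phi> (supp w) \<beta>)" "finite D" "D \<subseteq> direct_sum"
  shows "finite (\<Union>i. (wshift \<phi> w ^^ i) ` D)"
proof -
  define T where "T = (\<Union>\<beta>\<in>(\<Union>x\<in>D. supp x). backward_tree \<phi> (supp w) \<beta>)"
  have "finite T"
    using assms by (auto simp: T_def direct_sum_def)
  then have "finite {x :: 'g \<Rightarrow> 'f. \<forall>\<alpha>. (\<alpha> \<in> T \<longrightarrow> x \<alpha> \<in> UNIV) \<and> (\<alpha> \<notin> T \<longrightarrow> x \<alpha> = 0)}"
    by (rule finite_set_of_finite_funs) simp
  moreover have "(wshift \<phi> w ^^ i) x \<alpha> = 0" if "x \<in> D" "\<alpha> \<notin> T" for i x \<alpha>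
  proof (rule ccontr)
    assume "(wshift \<phi> w ^^ i) x \<alpha> \<noteq> 0"
    then have "(\<phi> ^^ i) \<alpha> \<in> supp x" "\<alpha> \<in> backward_tree \<phi> (supp w) ((\<phi> ^^ i) \<alpha>)"
      unfolding wshift_funpow_nonzero_iff by (auto simp: backward_tree_def supp_def)
    then show False
      using that by (auto simp: T_def)
  qed
  ultimately show ?thesis
    by (elim finite_subset[rotated]) auto
qed

section \<open>Infinite anti-orbits force infinite entropy\<close>

text \<open>If all terms were periodic, each would lie on the finite cycle through
  \<open>a 1\<close>, and the anti-orbit would be finite.\<close>

lemma infinite_anti_orbit_nonperiodic:
  assumes "anti_orbit \<phi> a" "infinite_seq a"
  obtains N where "N \<ge> 1" "\<And>p. p > 0 \<Longrightarrow> (\<phi> ^^ p) (a N) \<noteq> a N"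
proof (rule ccontr)
  assume "\<not> thesis"
  with that have per: "\<exists>p>0. (\<phi> ^^ p) (a n) = a n" if "n \<ge> 1" for n
    using \<open>n \<ge> 1\<close> by blast
  then obtain p where p: "p > 0" "(\<phi> ^^ p) (a 1) = a 1"
    by blast
  have "a n \<in> (\<lambda>i. (\<phi> ^^ i) (a 1)) ` {..<p}" if n: "n \<ge> 1" for n
  proof -
    define m where "m = n - 1"
    have m: "(\<phi> ^^ m) (a n) = a 1"
      using funpow_backward_seq[of \<phi> "\<lambda>n. a (Suc n)" m 0] assms(1) n
      by (simp add: anti_orbit_def m_def)
    obtain q where q: "q > 0" "(\<phi> ^^ q) (a n) = a n"
      using per n by blast
    \<comment> \<open>The multiple \<open>m * q\<close> of the period is at least \<open>m\<close>,
      so the way from \<open>a n\<close> back to itself passes through \<open>a 1\<close>.\<close>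
    have "m \<le> m * q"
      using q(1) by simp
    have "a n = (\<phi> ^^ (m * q)) (a n)"
      using funpow_mod_eq[OF q(2), of "m * q"] by simp
    also have "\<dots> = (\<phi> ^^ (m * q - m)) (a 1)"
      using \<open>m \<le> m * q\<close> m by (metis comp_apply funpow_add le_add_diff_inverse2)
    also have "\<dots> = (\<phi> ^^ ((m * q - m) mod p)) (a 1)"
      using funpow_mod_eq[OF p(2)] by simp
    finally show ?thesis
      using p(1) by auto
  qed
  then have "a ` {1..} \<subseteq> (\<lambda>i. (\<phi> ^^ i) (a 1)) ` {..<p}"
    by (intro image_subsetI) (simp only: atLeast_iff)
  then have "finite (a ` {1..})"
    by (rule finite_subset) simp
  then show False
    using assms(2) by (simp add: infinite_seq_def)
qed

text \<open>For \<open>m = 0\<close> the vector is \<open>basis_vec (c 0)\<close>.\<close>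

lemma wshift_funpow_pair_trace:
  fixes w :: "'g \<Rightarrow> 'f::idom"
  assumes step: "\<And>n. \<phi> (c (Suc n)) = c n"
    and w: "\<And>n. c n \<in> supp w"
    and nonper: "\<And>p. p > 0 \<Longrightarrow> (\<phi> ^^ p) (c 0) \<noteq> c 0"
  shows "{j. (wshift \<phi> w ^^ n) (\<lambda>\<alpha>. if \<alpha> = c 0 \<or> \<alpha> = c m then 1 else 0) (c j) \<noteq> 0} = {n, n + m}"
proof -
  have retrace: "(\<phi> ^^ k) (c j) = c (j - k)" if "k \<le> j" for k j
    using funpow_backward_seq[of \<phi> c k "j - k"] step that by simp
  have inj: "c i = c j \<longleftrightarrow> i = j" for i j
  proof -
    \<comment> \<open>A collision would make \<open>c 0\<close> periodic with period
      \<open>j - i\<close>.\<close>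
    have "c i \<noteq> c j" if "i < j" for i j
    proof
      assume "c i = c j"
      then have "(\<phi> ^^ (j - i)) (c 0) = (\<phi> ^^ (j - i)) ((\<phi> ^^ i) (c j))"
        using retrace[of i i] by simp
      also have "\<dots> = c 0"
        using retrace[of j j] \<open>i < j\<close>
        by (metis comp_apply diff_self_eq_0 funpow_add le_add_diff_inverse2 less_imp_le_nat order_refl)
      finally show False
        using nonper[of "j - i"] \<open>i < j\<close> by simp
    qed
    then show ?thesis
      by (metis linorder_neqE_nat)
  qed
  \<comment> \<open>After \<open>j\<close> steps the path is at \<open>c 0\<close>. Were it to land
    on some \<open>c l\<close> later, \<open>l\<close> further steps would close a cycle through
    \<open>c 0\<close>.\<close>
  have past_start: "(\<phi> ^^ n) (c j) \<noteq> c l" if "j < n" for j l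
  proof
    assume "(\<phi> ^^ n) (c j) = c l"
    then have "(\<phi> ^^ l) ((\<phi> ^^ (n - j)) ((\<phi> ^^ j) (c j))) = (\<phi> ^^ l) (c l)"
      using \<open>j < n\<close> by (metis comp_apply funpow_add le_add_diff_inverse2 less_imp_le_nat)
    then have "(\<phi> ^^ (l + (n - j))) (c 0) = c 0"
      by (simp add: retrace funpow_add)
    then show False
      using nonper[of "l + (n - j)"] \<open>j < n\<close> by simp
  qed
  have "(wshift \<phi> w ^^ n) (\<lambda>\<alpha>. if \<alpha> = c 0 \<or> \<alpha> = c m then 1 else 0) (c j) \<noteq> 0
      \<longleftrightarrow> j = n \<or> j = n + m" for j
  proof (cases "j < n")
    case True
    then show ?thesis
      by (auto simp: wshift_funpow_nonzero_iff past_start)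
  next
    case False
    then have "\<forall>i<n. (\<phi> ^^ i) (c j) \<in> supp w" "(\<phi> ^^ n) (c j) = c (j - n)"
      using w by (auto simp: retrace)
    then show ?thesis
      using False by (auto simp: wshift_funpow_nonzero_iff inj)
  qed
  then show ?thesis by auto
qed

lemma infinite_anti_orbit_consequences:
  fixes w :: "'g \<Rightarrow> 'f::idom"
  assumes a: "anti_orbit \<phi> a" "infinite_seq a" "seq_in a (supp w)"
  shows "ent_set direct_sum (wshift \<phi> w) = \<infinity>"
    and "\<exists>\<beta>. one_to_one_seq (\<lambda>n. (wshift \<phi> w ^^ n) (basis_vec \<beta>))"
proof -
  obtain N where N: "N \<ge> 1" "\<And>p. p > 0 \<Longrightarrow> (\<phi> ^^ p) (a N) \<noteq> a N"
    using infinite_anti_orbit_nonperiodic a by blast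
  \<comment> \<open>Since \<open>N \<ge> 1\<close>, the tail indexed from 0 uses only meaningful
    terms of \<open>a\<close>.\<close>
  define c where "c n = a (N + n)" for n
  define x :: "nat \<Rightarrow> 'g \<Rightarrow> 'f" where "x m \<alpha> = (if \<alpha> = c 0 \<or> \<alpha> = c m then 1 else 0)" for m \<alpha>
  have trace: "{j. (wshift \<phi> w ^^ n) (x m) (c j) \<noteq> 0} = {n, n + m}" for n m
    unfolding x_def
    by (rule wshift_funpow_pair_trace)
      (use a N in \<open>auto simp: c_def anti_orbit_def seq_in_def\<close>)
  have eqD: "{n, n + m} = {n', n' + m'}"
    if "(wshift \<phi> w ^^ n) (x m) = (wshift \<phi> w ^^ n') (x m')" for n m n' m'
    using trace[of n m] trace[of n' m'] that by simp
  have recover: "n = n' \<and> m = m'"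
    if "(wshift \<phi> w ^^ n) (x m) = (wshift \<phi> w ^^ n') (x m')" for n m n' m'
    using eqD[OF that] by (auto simp: doubleton_eq_iff)
  have x0: "x 0 = basis_vec (c 0)"
    by (auto simp: x_def basis_vec_def)
  have "inj_on (\<lambda>n. (wshift \<phi> w ^^ n) (x 0)) {1..}"
    using recover[of _ 0 _ 0] by (blast intro: inj_onI)
  then show "\<exists>\<beta>. one_to_one_seq (\<lambda>n. (wshift \<phi> w ^^ n) (basis_vec \<beta>))"
    unfolding one_to_one_seq_def x0 by blast
  have "inj x"
    using recover[of 0 _ 0] by (auto intro: injI)
  have "supp (x m) \<subseteq> {c 0, c m}" for m
    by (auto simp: x_def supp_def)
  then have ds: "x m \<in> direct_sum" for m
    unfolding direct_sum_def using finite_subset by blast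
  \<comment> \<open>By \<open>recover\<close>, the vectors \<open>x 0\<close> to
    \<open>x (k - 1)\<close> have pairwise disjoint one-to-one orbits, so together they contribute
    entropy \<open>k\<close>.\<close>
  have "ereal (real k) \<le> ent_set direct_sum (wshift \<phi> w)" for k
  proof -
    have "set_entropy_of (wshift \<phi> w) (x ` {..<k}) = real (card (x ` {..<k}))"
      by (rule set_entropy_of_eq_card) (auto intro!: inj_onI dest: recover)
    also have "card (x ` {..<k}) = k"
      using \<open>inj x\<close> by (simp add: card_image inj_on_subset)
    finally show ?thesis
      unfolding ent_set_def using ds
      by (intro SUP_upper2[of "x ` {..<k}"]) auto
  qed
  then show "ent_set direct_sum (wshift \<phi> w) = \<infinity>"
    by (intro ereal_top) (meson ereal_less_eq(3) order_trans real_arch_simple)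
qed

section \<open>The dichotomy\<close>

lemma no_anti_orbit_consequences:
  fixes w :: "'g \<Rightarrow> 'f::{idom, finite}"
  assumes inv: "wshift \<phi> w ` direct_sum \<subseteq> direct_sum"
    and none: "\<nexists>a. anti_orbit \<phi> a \<and> one_to_one_seq a \<and> seq_in a (supp w)"
  shows "ent_set direct_sum (wshift \<phi> w) = 0"
    and "\<nexists>\<beta>. one_to_one_seq (\<lambda>n. (wshift \<phi> w ^^ n) (basis_vec \<beta>))"
proof -
  have "finite (backward_tree \<phi> (supp w) \<beta>)" for \<beta>
    using none infinite_backward_tree_imp_anti_orbit[OF finite_weighted_fibre[OF inv]] by blast
  note fin = finite_orbits_of_finite_backward_trees[OF this]
  have "ent_set direct_sum (wshift \<phi> w)
      = (SUP D\<in>{D :: ('g \<Rightarrow> 'f) set. D \<subseteq> direct_sum \<and> finite D}. 0)"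
    unfolding ent_set_def
    by (rule SUP_cong) (auto simp: zero_ereal_def intro!: set_entropy_of_eq_0 fin)
  also have "\<dots> = 0"
    by (rule cSUP_const) auto
  finally show "ent_set direct_sum (wshift \<phi> w) = 0" .
  show "\<nexists>\<beta>. one_to_one_seq (\<lambda>n. (wshift \<phi> w ^^ n) (basis_vec \<beta>))"
  proof
    assume "\<exists>\<beta>. one_to_one_seq (\<lambda>n. (wshift \<phi> w ^^ n) (basis_vec \<beta>))"
    then obtain \<beta> where "inj_on (\<lambda>n. (wshift \<phi> w ^^ n) (basis_vec \<beta>)) {1..}"
      by (auto simp: one_to_one_seq_def)
    moreover have "finite ((\<lambda>n. (wshift \<phi> w ^^ n) (basis_vec \<beta>)) ` {1..})"
      by (rule finite_subset[OF _ fin[of "{basis_vec \<beta>}"]]) (auto simp: basis_vec_in_direct_sum)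
    ultimately have "finite {1::nat..}"
      by (rule finite_imageD[rotated])
    then show False
      using infinite_Ici by blast
  qed
qed

lemma one_to_one_seq_imp_infinite_seq: "one_to_one_seq a \<Longrightarrow> infinite_seq a"
  by (simp add: one_to_one_seq_def infinite_seq_def finite_image_iff infinite_Ici)

theorem theorem6p4:
  fixes \<phi> :: "'g \<Rightarrow> 'g"
    and w :: "'g \<Rightarrow> 'f::{field, finite}"
  assumes "wshift \<phi> w ` direct_sum \<subseteq> direct_sum"
  shows
    "((\<exists>\<alpha>. anti_orbit \<phi> \<alpha> \<and> infinite_seq \<alpha> \<and> seq_in \<alpha> (supp w))
        \<longleftrightarrow> ent_set direct_sum (wshift \<phi> w) = \<infinity>)
     \<and> (ent_set direct_sum (wshift \<phi> w) = \<infinity> \<longleftrightarrow> ent_set direct_sum (wshift \<phi> w) > 0)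
     \<and> (ent_set direct_sum (wshift \<phi> w) > 0
        \<longleftrightarrow> (\<exists>\<beta>. one_to_one_seq (\<lambda>n. (wshift \<phi> w ^^ n) (basis_vec \<beta>))))
     \<and> ((\<exists>\<alpha>. anti_orbit \<phi> \<alpha> \<and> one_to_one_seq \<alpha> \<and> seq_in \<alpha> (supp w))
        \<longrightarrow> ent_set direct_sum (wshift \<phi> w) = \<infinity>)
     \<and> (\<not> (\<exists>\<alpha>. anti_orbit \<phi> \<alpha> \<and> one_to_one_seq \<alpha> \<and> seq_in \<alpha> (supp w))
        \<longrightarrow> ent_set direct_sum (wshift \<phi> w) = 0)"
proof (cases "\<exists>\<alpha>. anti_orbit \<phi> \<alpha> \<and> one_to_one_seq \<alpha> \<and> seq_in \<alpha> (supp w)")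
  case True
  then obtain a where "anti_orbit \<phi> a" "infinite_seq a" "seq_in a (supp w)"
    using one_to_one_seq_imp_infinite_seq by blast
  with infinite_anti_orbit_consequences[OF this] True show ?thesis
    by auto
next
  case False
  note zero = no_anti_orbit_consequences[OF assms False]
  \<comment> \<open>An infinite anti-orbit may repeat terms, so \<open>False\<close> does not
    exclude it directly; it would yield a one-to-one sequence of iterates of a basis vector, which
    \<open>zero\<close> rules out.\<close>
  then have "\<nexists>\<alpha>. anti_orbit \<phi> \<alpha> \<and> infinite_seq \<alpha> \<and> seq_in \<alpha> (supp w)"
    using infinite_anti_orbit_consequences(2) by blast
  with zero False show ?thesis
    by auto
qed

end
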